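(* The variety $\mathsf{V}(ST_7)$ is exactly the class of all commutative ai-semirings satisfying the identities $$x\preceq y^2,\qquad x^2\approx x_1x_2x_3,\qquad x_1\preceq x_2+x_2x_3+x_1x_4,$$ together with, for every integer $n\ge 1$, the inequality $$\sigma_n:\quad x\preceq x_1x_2+x_2x_3+\cdots+x_{2n}x_{2n+1}+x_{2n+1}x_1 .$$
   Context: An additively idempotent semiring (ai-semiring) is an algebra $(S,+,\cdot)$ such that $(S,+)$ is a commutative idempotent semigroup, $(S,\cdot)$ is a semigroup, and $x(y+z)\approx xy+xz$, $(x+y)z\approx xz+yz$ hold; it is commutative if $xy\approx yx$ holds. $\mathsf{V}(A)$ denotes the variety generated by $A$, i.e. the smallest class of ai-semirings containing $A$ and closed under subalgebras, homomorphic images and arbitrary direct products. For terms $\mathbf u,\mathbf v$, the inequality $\mathbf u\preceq\mathbf v$ denotes the identity $\mathbf v\approx\mathbf v+\mathbf u$. Letters $x,y,x_1,x_2,\dots$ are distinct variables. $ST_7$ is the ai-semiring on $\{1,2,3,4,5,6,7\}$: addition is commutative and idempotent, with $1+a=1$ for all $a$, $2+5=2$, $4+6=4$, and every other sum of two distinct elements of $\{2,3,4,5,6,7\}$ equal to $7$; multiplication is commutative, with $2\cdot 6=4\cdot 5=5\cdot 6=3$ and every other product equal to $1$. *)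

theory Defs
  imports "HOL-Library.FuncSet"
begin

text \<open>The operations matter only on the carrier; their values elsewhere are irrelevant.\<close>

record 'a alg =
  carr :: "'a set"
  plus_of :: "'a \<Rightarrow> 'a \<Rightarrow> 'a"
  times_of :: "'a \<Rightarrow> 'a \<Rightarrow> 'a"

definition is_alg :: "'a alg \<Rightarrow> bool" where
  "is_alg S \<longleftrightarrow> carr S \<noteq> {} \<and>
     (\<forall>x\<in>carr S. \<forall>y\<in>carr S. plus_of S x y \<in> carr S \<and> times_of S x y \<in> carr S)"

definition ai_semiring :: "'a alg \<Rightarrow> bool" where
  "ai_semiring S \<longleftrightarrow> is_alg S \<and>
     (\<forall>x\<in>carr S. plus_of S x x = x) \<and>
     (\<forall>x\<in>carr S. \<forall>y\<in>carr S. plus_of S x y = plus_of S y x) \<and>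
     (\<forall>x\<in>carr S. \<forall>y\<in>carr S. \<forall>z\<in>carr S.
        plus_of S (plus_of S x y) z = plus_of S x (plus_of S y z) \<and>
        times_of S (times_of S x y) z = times_of S x (times_of S y z) \<and>
        times_of S x (plus_of S y z) = plus_of S (times_of S x y) (times_of S x z) \<and>
        times_of S (plus_of S x y) z = plus_of S (times_of S x z) (times_of S y z))"

definition comm_ai_semiring :: "'a alg \<Rightarrow> bool" where
  "comm_ai_semiring S \<longleftrightarrow> ai_semiring S \<and>
     (\<forall>x\<in>carr S. \<forall>y\<in>carr S. times_of S x y = times_of S y x)"

definition alg_hom :: "'a alg \<Rightarrow> 'b alg \<Rightarrow> ('a \<Rightarrow> 'b) \<Rightarrow> bool" where
  "alg_hom S T h \<longleftrightarrow> is_alg S \<and> is_alg T \<and> h \<in> carr S \<rightarrow> carr T \<and>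
     (\<forall>x\<in>carr S. \<forall>y\<in>carr S.
        h (plus_of S x y) = plus_of T (h x) (h y) \<and>
        h (times_of S x y) = times_of T (h x) (h y))"

definition hom_image :: "'b alg \<Rightarrow> 'a alg \<Rightarrow> bool" where
  "hom_image T S \<longleftrightarrow> (\<exists>h. alg_hom S T h \<and> h ` carr S = carr T)"

definition alg_iso :: "'a alg \<Rightarrow> 'b alg \<Rightarrow> bool" where
  "alg_iso S T \<longleftrightarrow> (\<exists>h. alg_hom S T h \<and> bij_betw h (carr S) (carr T))"

definition subalg :: "'a alg \<Rightarrow> 'a alg \<Rightarrow> bool" where
  "subalg T S \<longleftrightarrow> is_alg T \<and> carr T \<subseteq> carr S \<and>
     (\<forall>x\<in>carr T. \<forall>y\<in>carr T.
        plus_of T x y = plus_of S x y \<and> times_of T x y = times_of S x y)"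

definition prod_alg :: "'i set \<Rightarrow> ('i \<Rightarrow> 'a alg) \<Rightarrow> ('i \<Rightarrow> 'a) alg" where
  "prod_alg I A =
     \<lparr> carr = PiE I (\<lambda>i. carr (A i)),
       plus_of = (\<lambda>f g. \<lambda>i\<in>I. plus_of (A i) (f i) (g i)),
       times_of = (\<lambda>f g. \<lambda>i\<in>I. times_of (A i) (f i) (g i)) \<rparr>"

text \<open>
  HOL cannot quantify over classes whose members live on arbitrary types. Classes of ai-semirings
  are therefore taken relative to a universe type \<open>'u\<close>: they are sets of algebras whose carriers
  are subsets of \<open>'u\<close>. A product of members of a class is a function algebra and does not itself
  live on \<open>'u\<close>, so closure under products asks for all its isomorphic copies on \<open>'u\<close>;
  likewise the generator \<open>A\<close> is represented by its copies. Closure under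
  products is faithful only if \<open>'u\<close> is large enough to accommodate the products that are needed.
\<close>

definition closed_class :: "'u alg set \<Rightarrow> bool" where
  "closed_class K \<longleftrightarrow>
     (\<forall>S\<in>K. ai_semiring S) \<and>
     (\<forall>S\<in>K. \<forall>T. subalg T S \<longrightarrow> T \<in> K) \<and>
     (\<forall>S\<in>K. \<forall>T. hom_image T S \<longrightarrow> T \<in> K) \<and>
     (\<forall>(I :: 'u set) A P. (\<forall>i\<in>I. A i \<in> K) \<and> alg_iso (prod_alg I A) P \<longrightarrow> P \<in> K)"

definition variety_class :: "'b alg \<Rightarrow> 'u alg set" where
  "variety_class A = \<Inter>{K. closed_class K \<and> (\<forall>T. alg_iso A T \<longrightarrow> T \<in> K)}"

text \<open>The members, on an arbitrary type \<open>'a\<close>, of the variety computed in the universe \<open>'u\<close>.\<close>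

definition variety :: "'u itself \<Rightarrow> 'b alg \<Rightarrow> 'a alg set" where
  "variety U A = {S. \<exists>T :: 'u alg. T \<in> variety_class A \<and> alg_iso T S}"

datatype letter = Letter_x | Letter_y | Letter_xi nat

datatype trm =
    Var letter
  | Add trm trm  (infixl "\<oplus>" 65)
  | Mul trm trm  (infixl "\<odot>" 70)

primrec trm_val :: "'a alg \<Rightarrow> (letter \<Rightarrow> 'a) \<Rightarrow> trm \<Rightarrow> 'a" where
  "trm_val S v (Var a) = v a"
| "trm_val S v (s \<oplus> t) = plus_of S (trm_val S v s) (trm_val S v t)"
| "trm_val S v (s \<odot> t) = times_of S (trm_val S v s) (trm_val S v t)"

datatype identity = Identity trm trm  (infix "\<approx>" 50)

definition trm_le :: "trm \<Rightarrow> trm \<Rightarrow> identity"  (infix "\<preceq>" 50) where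
  "(s \<preceq> t) = (t \<approx> t \<oplus> s)"

fun satisfies :: "'a alg \<Rightarrow> identity \<Rightarrow> bool"  (infix "\<Turnstile>" 45) where
  "S \<Turnstile> (s \<approx> t) \<longleftrightarrow> (\<forall>v. range v \<subseteq> carr S \<longrightarrow> trm_val S v s = trm_val S v t)"

abbreviation var_x :: trm where "var_x \<equiv> Var Letter_x"
abbreviation var_y :: trm where "var_y \<equiv> Var Letter_y"
abbreviation var_xi :: "nat \<Rightarrow> trm" where "var_xi i \<equiv> Var (Letter_xi i)"

definition trm_sum :: "trm \<Rightarrow> trm list \<Rightarrow> trm" where
  "trm_sum t ts = foldl (\<oplus>) t ts"

definition sigma_ineq :: "nat \<Rightarrow> identity" where
  "sigma_ineq n =
     (var_x \<preceq> trm_sum (var_xi 1 \<odot> var_xi 2)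
             (map (\<lambda>i. var_xi i \<odot> var_xi (i + 1)) [2..<2 * n + 1] @ [var_xi (2 * n + 1) \<odot> var_xi 1]))"

definition ST7 :: "nat alg" where
  "ST7 =
     \<lparr> carr = {1, 2, 3, 4, 5, 6, 7},
       plus_of = (\<lambda>a b.
         if a = b then a
         else if a = 1 \<or> b = 1 then 1
         else if {a, b} = {2, 5} then 2
         else if {a, b} = {4, 6} then 4
         else 7),
       times_of = (\<lambda>a b. if {a, b} \<in> {{2, 6}, {4, 5}, {5, 6}} then 3 else 1) \<rparr>"

lemma comm_ai_semiring_ST7: "comm_ai_semiring ST7"
  by (simp add: comm_ai_semiring_def ai_semiring_def is_alg_def ST7_def doubleton_eq_iff)

end

theory Submission imports Defs begin

text \<open>
  Soundness is the easy half of Birkhoff's theorem: identities pass to subalgebras, homomorphic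
  images and products (\<open>closed_class_models\<close>), and \<open>ST7\<close> satisfies those listed. The only
  one that needs thought is \<open>\<sigma>\<^sub>n\<close>. A product in \<open>ST7\<close> is \<open>3\<close> exactly on the edges of the path
  \<open>2 - 6 - 5 - 4\<close> and is the top element \<open>1\<close> otherwise. A sum of products different from \<open>1\<close>
  would map an odd closed walk into this path, which is bipartite.

  For completeness, let \<open>S\<close> satisfy the identities and let \<open>s\<close> be an element of \<open>S\<close>. The core
  (\<open>models_ST7_cut\<close>) is that the words over \<open>S\<close> with value at most \<open>s\<close> are exactly those
  whose value in \<open>ST7\<close> is at most a bound \<open>c\<close> for all of a family of valuations \<open>\<phi> x\<close>, indexed by
  \<open>x \<in> S\<close>. This is clear if \<open>s\<close> is the top of \<open>S\<close>. Otherwise squares and products of three or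
  more factors are not below \<open>s\<close>, so only the elements \<open>z \<le> s\<close> and the graph with edges
  \<open>z z' \<le> s\<close> matter. By the inequalities \<open>\<sigma>\<^sub>n\<close> this graph has no odd closed walk, hence it has a
  proper two-colouring, which sends it into the path \<open>2 - 6 - 5 - 4\<close>. The identity
  \<open>x\<^sub>1 \<preceq> x\<^sub>2 + x\<^sub>2x\<^sub>3 + x\<^sub>1x\<^sub>4\<close> says that if one non-isolated vertex lies below \<open>s\<close> then all of
  them do. According to which case holds, \<open>c\<close> is \<open>7\<close> or \<open>3\<close>: the values \<open>2, 4, 5, 6\<close> of
  the non-isolated vertices lie below \<open>7\<close> but not below \<open>3\<close>.

  Since an element of \<open>S\<close> is determined by the elements above it, two formal polynomials over \<open>S\<close>
  with the same values in \<open>ST7\<close> under all these valuations have the same value in \<open>S\<close>. So \<open>S\<close>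
  is a homomorphic image of a subalgebra of a power of \<open>ST7\<close>. The exponent is the set of pairs
  \<open>(s, x)\<close>. Keeping it this small, rather than using all valuations of the variables, makes the
  power fit into any universe that is as large as the powerset of \<open>'a + nat\<close>.
\<close>

section \<open>Identities and the class operators\<close>

lemma trm_val_in_carr:
  assumes "is_alg S" "range v \<subseteq> carr S"
  shows "trm_val S v t \<in> carr S"
  using assms by (induction t) (auto simp: is_alg_def)

lemma trm_val_hom:
  assumes "alg_hom S T h" "range v \<subseteq> carr S"
  shows "trm_val T (h \<circ> v) t = h (trm_val S v t)"
proof (induction t)
  case (Var a)
  then show ?case by simp
next
  case (Add s t)
  then show ?case
    using assms trm_val_in_carr[OF _ assms(2)] by (simp add: alg_hom_def)
next
  case (Mul s t)
  then show ?case
    using assms trm_val_in_carr[OF _ assms(2)] by (simp add: alg_hom_def)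
qed

lemma trm_val_subalg:
  assumes "subalg T S" "range v \<subseteq> carr T"
  shows "trm_val T v t = trm_val S v t"
proof (induction t)
  case (Var a)
  then show ?case by simp
next
  case (Add s t)
  have "trm_val T v s \<in> carr T" "trm_val T v t \<in> carr T"
    using assms trm_val_in_carr[of T v] by (auto simp: subalg_def)
  then have "trm_val T v (s \<oplus> t) = plus_of S (trm_val T v s) (trm_val T v t)"
    using assms by (simp add: subalg_def)
  then show ?case using Add by simp
next
  case (Mul s t)
  have "trm_val T v s \<in> carr T" "trm_val T v t \<in> carr T"
    using assms trm_val_in_carr[of T v] by (auto simp: subalg_def)
  then have "trm_val T v (s \<odot> t) = times_of S (trm_val T v s) (trm_val T v t)"
    using assms by (simp add: subalg_def)
  then show ?case using Mul by simp
qed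

lemma trm_val_prod:
  assumes "i \<in> I"
  shows "trm_val (prod_alg I A) v t i = trm_val (A i) (\<lambda>a. v a i) t"
  using assms by (induction t) (simp_all add: prod_alg_def)

lemma satisfies_subalg:
  assumes "S \<Turnstile> i" "subalg T S"
  shows "T \<Turnstile> i"
proof (cases i)
  case (Identity s t)
  have "trm_val T v s = trm_val T v t" if "range v \<subseteq> carr T" for v
  proof -
    have "range v \<subseteq> carr S" using that assms(2) by (auto simp: subalg_def)
    then show ?thesis
      using assms(1) trm_val_subalg[OF assms(2) that] Identity by simp
  qed
  then show ?thesis using Identity by simp
qed

lemma satisfies_hom_image:
  assumes "S \<Turnstile> i" "hom_image T S"
  shows "T \<Turnstile> i"
proof (cases i)
  case (Identity s t)
  obtain h where h: "alg_hom S T h" "h ` carr S = carr T"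
    using assms(2) by (auto simp: hom_image_def)
  have "trm_val T v s = trm_val T v t" if "range v \<subseteq> carr T" for v
  proof -
    let ?w = "inv_into (carr S) h \<circ> v"
    have w: "range ?w \<subseteq> carr S"
      using that h(2) inv_into_into[of _ h "carr S"] by (auto simp: subset_iff)
    have "h \<circ> ?w = v"
      using that h(2) by (auto simp: fun_eq_iff f_inv_into_f subset_iff)
    then show ?thesis
      using trm_val_hom[OF h(1) w] assms(1) w Identity by (metis satisfies.simps)
  qed
  then show ?thesis using Identity by simp
qed

lemma satisfies_prod:
  assumes "is_alg (prod_alg I A)" "\<And>j. j \<in> I \<Longrightarrow> A j \<Turnstile> i"
  shows "prod_alg I A \<Turnstile> i"
proof (cases i)
  case (Identity s t)
  have "trm_val (prod_alg I A) v s = trm_val (prod_alg I A) v t"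
    if v: "range v \<subseteq> carr (prod_alg I A)" for v
  proof (rule PiE_ext)
    show "trm_val (prod_alg I A) v s \<in> PiE I (\<lambda>i. carr (A i))"
      "trm_val (prod_alg I A) v t \<in> PiE I (\<lambda>i. carr (A i))"
      using trm_val_in_carr[OF assms(1) v] by (auto simp: prod_alg_def)
    fix j assume j: "j \<in> I"
    have "range (\<lambda>a. v a j) \<subseteq> carr (A j)"
      using v j by (auto simp: prod_alg_def PiE_def)
    then show "trm_val (prod_alg I A) v s j = trm_val (prod_alg I A) v t j"
      using assms(2)[OF j] Identity by (simp add: trm_val_prod[OF j])
  qed
  then show ?thesis using Identity by simp
qed

lemma alg_iso_imp_hom_image: "alg_iso S T \<Longrightarrow> hom_image T S"
  by (auto simp: alg_iso_def hom_image_def bij_betw_def)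

text \<open>
  The defining laws of commutative ai-semirings are themselves rendered as identities, so that
  one preservation argument covers them along with the additional axioms.
\<close>

definition comm_ai_identities :: "identity set" where
  "comm_ai_identities =
    {var_x \<oplus> var_x \<approx> var_x,
     var_x \<oplus> var_y \<approx> var_y \<oplus> var_x,
     var_x \<oplus> var_y \<oplus> var_xi 0 \<approx> var_x \<oplus> (var_y \<oplus> var_xi 0),
     var_x \<odot> var_y \<odot> var_xi 0 \<approx> var_x \<odot> (var_y \<odot> var_xi 0),
     var_x \<odot> (var_y \<oplus> var_xi 0) \<approx> var_x \<odot> var_y \<oplus> var_x \<odot> var_xi 0,
     (var_x \<oplus> var_y) \<odot> var_xi 0 \<approx> var_x \<odot> var_xi 0 \<oplus> var_y \<odot> var_xi 0,
     var_x \<odot> var_y \<approx> var_y \<odot> var_x}"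

lemma comm_ai_semiring_iff_identities:
  "comm_ai_semiring S \<longleftrightarrow> is_alg S \<and> (\<forall>i\<in>comm_ai_identities. S \<Turnstile> i)"
proof
  assume "comm_ai_semiring S"
  then show "is_alg S \<and> (\<forall>i\<in>comm_ai_identities. S \<Turnstile> i)"
    by (simp add: comm_ai_semiring_def ai_semiring_def comm_ai_identities_def image_subset_iff)
next
  assume S: "is_alg S \<and> (\<forall>i\<in>comm_ai_identities. S \<Turnstile> i)"
  let ?v = "\<lambda>a b c l. case l of Letter_x \<Rightarrow> a | Letter_y \<Rightarrow> b | Letter_xi _ \<Rightarrow> c"
  have v: "range (?v a b c) \<subseteq> carr S" if "a \<in> carr S" "b \<in> carr S" "c \<in> carr S" for a b c
    using that by (auto split: letter.split)
  have i: "trm_val S (?v a b c) s = trm_val S (?v a b c) t"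
    if "(s \<approx> t) \<in> comm_ai_identities" "a \<in> carr S" "b \<in> carr S" "c \<in> carr S" for a b c s t
  proof -
    have "S \<Turnstile> (s \<approx> t)" using S that(1) by blast
    then show ?thesis using v[OF that(2-4)] by simp
  qed
  show "comm_ai_semiring S"
    unfolding comm_ai_semiring_def ai_semiring_def
  proof (intro conjI ballI)
    show "is_alg S" using S by blast
  next
    fix a assume "a \<in> carr S"
    then show "plus_of S a a = a"
      using i[of "var_x \<oplus> var_x" "var_x" a a a] by (simp add: comm_ai_identities_def)
  next
    fix a b assume "a \<in> carr S" "b \<in> carr S"
    then show "plus_of S a b = plus_of S b a" "times_of S a b = times_of S b a"
      using i[of "var_x \<oplus> var_y" "var_y \<oplus> var_x" a b a]
        i[of "var_x \<odot> var_y" "var_y \<odot> var_x" a b a]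
      by (simp_all add: comm_ai_identities_def)
  next
    fix a b c assume "a \<in> carr S" "b \<in> carr S" "c \<in> carr S"
    then show "plus_of S (plus_of S a b) c = plus_of S a (plus_of S b c)"
      "times_of S (times_of S a b) c = times_of S a (times_of S b c)"
      "times_of S a (plus_of S b c) = plus_of S (times_of S a b) (times_of S a c)"
      "times_of S (plus_of S a b) c = plus_of S (times_of S a c) (times_of S b c)"
      using i[of "var_x \<oplus> var_y \<oplus> var_xi 0" "var_x \<oplus> (var_y \<oplus> var_xi 0)" a b c]
        i[of "var_x \<odot> var_y \<odot> var_xi 0" "var_x \<odot> (var_y \<odot> var_xi 0)" a b c]
        i[of "var_x \<odot> (var_y \<oplus> var_xi 0)" "var_x \<odot> var_y \<oplus> var_x \<odot> var_xi 0" a b c]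
        i[of "(var_x \<oplus> var_y) \<odot> var_xi 0" "var_x \<odot> var_xi 0 \<oplus> var_y \<odot> var_xi 0" a b c]
      by (simp_all add: comm_ai_identities_def)
  qed
qed

definition models :: "identity set \<Rightarrow> 'a alg set" where
  "models \<Sigma> = {S. comm_ai_semiring S \<and> (\<forall>i\<in>\<Sigma>. S \<Turnstile> i)}"

lemma models_eq: "models \<Sigma> = {S. is_alg S \<and> (\<forall>i\<in>comm_ai_identities \<union> \<Sigma>. S \<Turnstile> i)}"
  by (auto simp: models_def comm_ai_semiring_iff_identities)

lemma models_hom_image: "S \<in> models \<Sigma> \<Longrightarrow> hom_image T S \<Longrightarrow> T \<in> models \<Sigma>"
  using satisfies_hom_image[of S _ T] by (auto simp: models_eq hom_image_def alg_hom_def)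

lemma closed_class_models: "closed_class (models \<Sigma>)"
  unfolding closed_class_def
proof (intro conjI ballI allI impI)
  show "ai_semiring S" if "S \<in> models \<Sigma>" for S :: "'a alg"
    using that by (auto simp: models_def comm_ai_semiring_def)
  show "T \<in> models \<Sigma>" if "S \<in> models \<Sigma>" "subalg T S" for S T :: "'a alg"
    using that satisfies_subalg[of S _ T] by (auto simp: models_eq subalg_def)
  show "T \<in> models \<Sigma>" if "S \<in> models \<Sigma>" "hom_image T S" for S T :: "'a alg"
    using that by (rule models_hom_image)
  fix I :: "'a set" and A P
  assume *: "(\<forall>i\<in>I. A i \<in> models \<Sigma>) \<and> alg_iso (prod_alg I A) P"
  have "is_alg (prod_alg I A)"
    using * by (auto simp: alg_iso_def alg_hom_def)
  then have "prod_alg I A \<in> models \<Sigma>"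
    using * satisfies_prod[of I A] by (auto simp: models_eq)
  then show "P \<in> models \<Sigma>"
    using * alg_iso_imp_hom_image models_hom_image by blast
qed

lemma variety_subset_models:
  assumes "A \<in> models \<Sigma>"
  shows "variety TYPE('u) A \<subseteq> models \<Sigma>"
proof
  fix S assume "S \<in> variety TYPE('u) A"
  then obtain T :: "'u alg" where T: "T \<in> variety_class A" "alg_iso T S"
    by (auto simp: variety_def)
  have "\<forall>T :: 'u alg. alg_iso A T \<longrightarrow> T \<in> models \<Sigma>"
    using assms alg_iso_imp_hom_image models_hom_image by blast
  then have "T \<in> models \<Sigma>"
    using T(1) closed_class_models by (auto simp: variety_class_def)
  then show "S \<in> models \<Sigma>"
    using T(2) alg_iso_imp_hom_image models_hom_image by blast
qed

section \<open>Membership in a variety from a separating family\<close>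

text \<open>Transport of structure along a map that is injective on the carrier.\<close>

definition copy_alg :: "('a \<Rightarrow> 'b) \<Rightarrow> 'a alg \<Rightarrow> 'b alg" where
  "copy_alg f A = (let g = inv_into (carr A) f in
     \<lparr> carr = f ` carr A,
       plus_of = (\<lambda>x y. f (plus_of A (g x) (g y))),
       times_of = (\<lambda>x y. f (times_of A (g x) (g y))) \<rparr>)"

lemma alg_iso_copy:
  assumes "is_alg A" "inj_on f (carr A)"
  shows "alg_hom A (copy_alg f A) f" "alg_iso A (copy_alg f A)"
proof -
  have "is_alg (copy_alg f A)"
    using assms by (auto simp: is_alg_def copy_alg_def Let_def)
  then show "alg_hom A (copy_alg f A) f"
    using assms by (auto simp: alg_hom_def copy_alg_def Let_def)
  then show "alg_iso A (copy_alg f A)"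
    using assms(2) unfolding alg_iso_def
    by (intro exI[of _ f]) (auto simp: bij_betw_def copy_alg_def Let_def)
qed

lemma alg_iso_sym:
  assumes "alg_iso A B"
  shows "alg_iso B A"
proof -
  obtain h where h: "alg_hom A B h" "bij_betw h (carr A) (carr B)"
    using assms by (auto simp: alg_iso_def)
  define g where "g = inv_into (carr A) h"
  have bij: "bij_betw g (carr B) (carr A)"
    using h(2) by (simp add: g_def bij_betw_inv_into)
  have hg: "h (g y) = y" "g y \<in> carr A" if "y \<in> carr B" for y
    using h(2) that bij by (auto simp: g_def bij_betw_inv_into_right bij_betw_apply)
  have gh: "g (h x) = x" if "x \<in> carr A" for x
    using h(2) that by (simp add: g_def bij_betw_inv_into_left)
  have A: "is_alg A" "is_alg B" using h(1) by (auto simp: alg_hom_def)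
  have "g (plus_of B x y) = plus_of A (g x) (g y) \<and> g (times_of B x y) = times_of A (g x) (g y)"
    if "x \<in> carr B" "y \<in> carr B" for x y
  proof -
    have "h (plus_of A (g x) (g y)) = plus_of B x y" "h (times_of A (g x) (g y)) = times_of B x y"
      using h(1) hg that by (auto simp: alg_hom_def)
    then show ?thesis
      using gh hg that A(1) by (metis is_alg_def)
  qed
  then have "alg_hom B A g"
    using A hg by (auto simp: alg_hom_def)
  then show ?thesis using bij by (auto simp: alg_iso_def)
qed

lemma alg_hom_comp:
  "alg_hom A B f \<Longrightarrow> alg_hom B C g \<Longrightarrow> alg_hom A C (g \<circ> f)"
  by (auto simp: alg_hom_def Pi_iff)

text \<open>
  The image of \<open>f\<close> is a subalgebra of \<open>P\<close>, and because the kernel of \<open>f\<close> is contained in that of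
  \<open>g\<close>, the map \<open>g\<close> factors through it. The algebra \<open>W\<close> may live on any type and need not satisfy
  any laws.
\<close>

lemma closed_class_kernel:
  assumes K: "closed_class K" "P \<in> K"
    and f: "alg_hom W P f"
    and g: "alg_hom W T g" "g ` carr W = carr T"
    and ker: "\<And>p q. p \<in> carr W \<Longrightarrow> q \<in> carr W \<Longrightarrow> f p = f q \<Longrightarrow> g p = g q"
  shows "T \<in> K"
proof -
  define B where "B = P\<lparr>carr := f ` carr W\<rparr>"
  have B: "subalg B P"
    unfolding subalg_def is_alg_def
  proof (intro conjI ballI)
    show "carr B \<noteq> {}" "carr B \<subseteq> carr P"
      using f by (auto simp: B_def alg_hom_def is_alg_def)
    fix x y assume "x \<in> carr B" "y \<in> carr B"
    then obtain p q where pq: "p \<in> carr W" "q \<in> carr W" "x = f p" "y = f q"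
      by (auto simp: B_def)
    then have "plus_of P x y = f (plus_of W p q)" "times_of P x y = f (times_of W p q)"
      "plus_of W p q \<in> carr W" "times_of W p q \<in> carr W"
      using f by (auto simp: alg_hom_def is_alg_def)
    then show "plus_of B x y \<in> carr B" "times_of B x y \<in> carr B"
      by (auto simp: B_def)
    show "plus_of B x y = plus_of P x y" "times_of B x y = times_of P x y"
      by (simp_all add: B_def)
  qed
  define h where "h = g \<circ> inv_into (carr W) f"
  have hf: "h (f p) = g p" if "p \<in> carr W" for p
    using that ker[of "inv_into (carr W) f (f p)" p]
    by (simp add: h_def inv_into_into f_inv_into_f)
  have "alg_hom B T h"
    unfolding alg_hom_def
  proof (intro conjI ballI)
    show "is_alg B" using B by (simp add: subalg_def)
    show "is_alg T" using g by (simp add: alg_hom_def)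
    show "h \<in> carr B \<rightarrow> carr T" using hf g(2) by (auto simp: B_def)
    fix x y assume "x \<in> carr B" "y \<in> carr B"
    then obtain p q where pq: "p \<in> carr W" "q \<in> carr W" "x = f p" "y = f q"
      by (auto simp: B_def)
    then have "plus_of B x y = f (plus_of W p q)" "times_of B x y = f (times_of W p q)"
      "plus_of W p q \<in> carr W" "times_of W p q \<in> carr W"
      using f by (auto simp: alg_hom_def is_alg_def B_def)
    then show "h (plus_of B x y) = plus_of T (h x) (h y)"
      "h (times_of B x y) = times_of T (h x) (h y)"
      using hf pq g(1) by (auto simp: alg_hom_def)
  qed
  moreover have "h ` carr B = carr T"
    using hf g(2) by (force simp: B_def image_iff)
  ultimately have "hom_image T B" by (auto simp: hom_image_def)
  then show ?thesis using K B unfolding closed_class_def by blast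
qed

lemma alg_hom_prod:
  assumes "is_alg W" "\<And>i. i \<in> I \<Longrightarrow> alg_hom W (A i) (f i)"
  shows "alg_hom W (prod_alg I A) (\<lambda>p. \<lambda>i\<in>I. f i p)"
proof -
  have "is_alg (prod_alg I A)"
  proof -
    have "is_alg (A i)" if "i \<in> I" for i using assms(2)[OF that] by (simp add: alg_hom_def)
    then show ?thesis
      by (auto simp: is_alg_def prod_alg_def PiE_eq_empty_iff PiE_iff)
  qed
  then show ?thesis
    using assms by (auto simp: alg_hom_def prod_alg_def is_alg_def Pi_iff intro!: restrict_ext)
qed

text \<open>
  The homomorphisms \<open>f j\<close> combine to one from \<open>W\<close> into the power of \<open>A\<close> with exponent \<open>'j\<close>. The
  injections \<open>d\<close> and \<open>E\<close> provide the two things that the universe must accommodate: the index set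
  and the whole power.
\<close>

lemma variety_class_if_separated:
  fixes d :: "'j \<Rightarrow> 'u" and f :: "'j \<Rightarrow> 'w \<Rightarrow> 'b" and E :: "('j \<Rightarrow> 'b) \<Rightarrow> 'u" and A :: "'b alg" and T :: "'u alg"
  assumes d: "inj d" and E: "inj E"
    and f: "\<And>j. alg_hom W A (f j)"
    and g: "alg_hom W T g" "g ` carr W = carr T"
    and ker: "\<And>p q. p \<in> carr W \<Longrightarrow> q \<in> carr W \<Longrightarrow> (\<And>j. f j p = f j q) \<Longrightarrow> g p = g q"
  shows "T \<in> variety_class A"
  unfolding variety_class_def
proof (intro InterI)
  fix K :: "'u alg set"
  assume "K \<in> {K. closed_class K \<and> (\<forall>T. alg_iso A T \<longrightarrow> T \<in> K)}"
  then have K: "closed_class K" "\<And>T. alg_iso A T \<Longrightarrow> T \<in> K" by auto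
  \<comment> \<open>The constant functions also give a copy of \<open>A\<close> itself inside the universe.\<close>
  define c where "c b = E (\<lambda>_. b)" for b
  have c: "inj c" using E by (auto simp: c_def inj_def fun_eq_iff)
  have A: "is_alg A" and W: "is_alg W" using f by (auto simp: alg_hom_def)
  have iso: "alg_hom A (copy_alg c A) c" "alg_iso A (copy_alg c A)"
    using alg_iso_copy[OF A] c by (meson inj_on_subset subset_UNIV)+
  define I where "I = range d"
  define Q where "Q = prod_alg I (\<lambda>_. copy_alg c A)"
  define F where "F p = (\<lambda>i\<in>I. (c \<circ> f (inv d i)) p)" for p
  have F: "alg_hom W Q F"
    unfolding Q_def F_def using W alg_hom_comp[OF f iso(1)] by (intro alg_hom_prod)
  define G where "G x = E (\<lambda>j. inv c (x (d j)))" for x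
  have G: "inj_on G (carr Q)"
  proof (rule inj_onI)
    fix x y assume x: "x \<in> carr Q" and y: "y \<in> carr Q" and "G x = G y"
    then have *: "inv c (x (d j)) = inv c (y (d j))" for j
      using fun_cong[OF injD[OF E], of "\<lambda>j. inv c (x (d j))" "\<lambda>j. inv c (y (d j))" j]
      by (simp add: G_def)
    have C: "x \<in> PiE I (\<lambda>i. c ` carr A)" "y \<in> PiE I (\<lambda>i. c ` carr A)"
      using x y by (auto simp: Q_def prod_alg_def copy_alg_def Let_def)
    show "x = y"
    proof (rule PiE_ext[OF C])
      fix i assume i: "i \<in> I"
      then obtain j where j: "i = d j" by (auto simp: I_def)
      have "x i \<in> range c" "y i \<in> range c" using C i by (auto simp: PiE_iff)
      then show "x i = y i" using *[of j] j by (metis f_inv_into_f)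
    qed
  qed
  have Q: "is_alg Q" using F by (simp add: alg_hom_def)
  define P where "P = copy_alg G Q"
  have P: "alg_hom Q P G" "alg_iso Q P"
    using alg_iso_copy[OF Q G] by (simp_all add: P_def)
  have "P \<in> K"
  proof -
    have "\<forall>(I :: 'u set) A P. (\<forall>i\<in>I. A i \<in> K) \<and> alg_iso (prod_alg I A) P \<longrightarrow> P \<in> K"
      using K(1) unfolding closed_class_def by (elim conjE)
    note this[THEN spec, THEN spec, of I "\<lambda>_. copy_alg c A", THEN spec, of P, folded Q_def, THEN mp]
    then show ?thesis using K(2)[OF iso(2)] P(2) by simp
  qed
  moreover have "alg_hom W P (G \<circ> F)" by (rule alg_hom_comp[OF F P(1)])
  moreover have "g p = g q" if "p \<in> carr W" "q \<in> carr W" "(G \<circ> F) p = (G \<circ> F) q" for p q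
  proof (rule ker[OF that(1,2)])
    fix j
    have "F p \<in> carr Q" "F q \<in> carr Q" using F that by (auto simp: alg_hom_def)
    then have "F p = F q" using G that(3) by (auto simp: inj_on_def)
    then have "F p (d j) = F q (d j)" by simp
    then have "c (f j p) = c (f j q)" by (simp add: F_def I_def inv_f_f[OF d])
    then show "f j p = f j q" by (rule injD[OF c])
  qed
  ultimately show "T \<in> K" using closed_class_kernel[OF K(1)] g by blast
qed

section \<open>The order and formal polynomials of an ai-semiring\<close>

definition alg_le :: "'a alg \<Rightarrow> 'a \<Rightarrow> 'a \<Rightarrow> bool" where
  "alg_le S a b \<longleftrightarrow> plus_of S b a = b"

lemma satisfies_trm_le:
  "S \<Turnstile> (s \<preceq> t) \<longleftrightarrow> (\<forall>v. range v \<subseteq> carr S \<longrightarrow> alg_le S (trm_val S v s) (trm_val S v t))"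
  by (auto simp: trm_le_def alg_le_def)

lemma ai_closed:
  assumes "ai_semiring S" "x \<in> carr S" "y \<in> carr S"
  shows "plus_of S x y \<in> carr S" "times_of S x y \<in> carr S"
  using assms by (auto simp: ai_semiring_def is_alg_def)

lemma ai_plus:
  assumes "ai_semiring S"
  shows "x \<in> carr S \<Longrightarrow> plus_of S x x = x"
    and "x \<in> carr S \<Longrightarrow> y \<in> carr S \<Longrightarrow> plus_of S x y = plus_of S y x"
    and "x \<in> carr S \<Longrightarrow> y \<in> carr S \<Longrightarrow> z \<in> carr S \<Longrightarrow>
      plus_of S (plus_of S x y) z = plus_of S x (plus_of S y z)"
  using assms by (simp_all add: ai_semiring_def)

lemma ai_times:
  assumes "ai_semiring S" "x \<in> carr S" "y \<in> carr S" "z \<in> carr S"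
  shows "times_of S (times_of S x y) z = times_of S x (times_of S y z)"
    and "times_of S x (plus_of S y z) = plus_of S (times_of S x y) (times_of S x z)"
    and "times_of S (plus_of S x y) z = plus_of S (times_of S x z) (times_of S y z)"
  using assms by (simp_all add: ai_semiring_def)

lemma alg_le_refl: "ai_semiring S \<Longrightarrow> x \<in> carr S \<Longrightarrow> alg_le S x x"
  by (simp add: ai_plus alg_le_def)

lemma alg_le_antisym:
  assumes "ai_semiring S" "x \<in> carr S" "y \<in> carr S" "alg_le S x y" "alg_le S y x"
  shows "x = y"
  using assms(4,5) ai_plus(2)[OF assms(1,2,3)] by (simp add: alg_le_def)

lemma alg_le_trans:
  assumes "ai_semiring S" "x \<in> carr S" "y \<in> carr S" "z \<in> carr S" "alg_le S x y" "alg_le S y z"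
  shows "alg_le S x z"
  using assms(5,6) ai_plus(3)[OF assms(1,4,3,2)] by (simp add: alg_le_def)

lemma plus_le_iff:
  assumes "ai_semiring S" "x \<in> carr S" "y \<in> carr S" "z \<in> carr S"
  shows "alg_le S (plus_of S x y) z \<longleftrightarrow> alg_le S x z \<and> alg_le S y z"
proof
  note closed = ai_closed(1)[OF assms(1)] and ai = ai_plus[OF assms(1)]
  have upper: "alg_le S x (plus_of S x y)" "alg_le S y (plus_of S x y)"
    using ai(1)[of x] ai(1)[of y] ai(2)[of "plus_of S x y" x] ai(3)[of x x y] ai(3)[of x y y]
      assms closed by (simp_all add: alg_le_def)
  assume "alg_le S (plus_of S x y) z"
  then show "alg_le S x z \<and> alg_le S y z"
    using upper alg_le_trans[OF assms(1)] assms closed by blast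
next
  assume "alg_le S x z \<and> alg_le S y z"
  then show "alg_le S (plus_of S x y) z"
    using ai_plus(3)[OF assms(1,4,2,3)] by (simp add: alg_le_def)
qed

lemma trm_val_trm_sum_le_iff:
  assumes "ai_semiring S" "range v \<subseteq> carr S" "a \<in> carr S"
  shows "alg_le S (trm_val S v (trm_sum t ts)) a \<longleftrightarrow>
    (\<forall>r\<in>insert t (set ts). alg_le S (trm_val S v r) a)"
proof -
  have "trm_val S v r \<in> carr S" for r
    using trm_val_in_carr assms(1,2) by (auto simp: ai_semiring_def)
  then show ?thesis
    unfolding trm_sum_def
    by (induction ts arbitrary: t) (auto simp: plus_le_iff assms)
qed

text \<open>
  Formal polynomials are nonempty lists of nonempty words. No laws are imposed on them: the
  evaluation maps absorb associativity and distributivity, and \<open>closed_class_kernel\<close> accepts any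
  algebra as source. There are no neutral elements in an ai-semiring, hence the fold over
  nonempty lists only.
\<close>

fun fold1 :: "('a \<Rightarrow> 'a \<Rightarrow> 'a) \<Rightarrow> 'a list \<Rightarrow> 'a" where
  "fold1 f [x] = x"
| "fold1 f (x # y # xs) = f x (fold1 f (y # xs))"

lemma fold1_Cons: "xs \<noteq> [] \<Longrightarrow> fold1 f (x # xs) = f x (fold1 f xs)"
  by (cases xs) auto

lemma fold1_closed:
  assumes "\<And>x y. x \<in> C \<Longrightarrow> y \<in> C \<Longrightarrow> f x y \<in> C" "xs \<noteq> []" "set xs \<subseteq> C"
  shows "fold1 f xs \<in> C"
  using assms(2,3) by (induction xs rule: list_nonempty_induct) (auto simp: fold1_Cons assms(1))

lemma fold1_append:
  assumes closed: "\<And>x y. x \<in> C \<Longrightarrow> y \<in> C \<Longrightarrow> f x y \<in> C"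
    and assoc: "\<And>x y z. x \<in> C \<Longrightarrow> y \<in> C \<Longrightarrow> z \<in> C \<Longrightarrow> f (f x y) z = f x (f y z)"
    and "xs \<noteq> []" "set xs \<subseteq> C" "ys \<noteq> []" "set ys \<subseteq> C"
  shows "fold1 f (xs @ ys) = f (fold1 f xs) (fold1 f ys)"
  using assms(3,4)
proof (induction xs rule: list_nonempty_induct)
  case (single x)
  then show ?case using assms(5) by (simp add: fold1_Cons)
next
  case (cons x xs)
  then show ?case
    using assoc[of x "fold1 f xs" "fold1 f ys"] fold1_closed[OF closed] assms(5,6)
    by (auto simp: fold1_Cons)
qed

definition word_val :: "'b alg \<Rightarrow> ('a \<Rightarrow> 'b) \<Rightarrow> 'a list \<Rightarrow> 'b" where
  "word_val M \<phi> w = fold1 (times_of M) (map \<phi> w)"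

definition poly_val :: "'b alg \<Rightarrow> ('a \<Rightarrow> 'b) \<Rightarrow> 'a list list \<Rightarrow> 'b" where
  "poly_val M \<phi> p = fold1 (plus_of M) (map (word_val M \<phi>) p)"

definition words :: "'a set \<Rightarrow> 'a list set" where
  "words X = {w. w \<noteq> [] \<and> set w \<subseteq> X}"

definition poly_alg :: "'a set \<Rightarrow> 'a list list alg" where
  "poly_alg X =
     \<lparr> carr = {p. p \<noteq> [] \<and> set p \<subseteq> words X},
       plus_of = (@),
       times_of = (\<lambda>p q. concat (map (\<lambda>u. map (\<lambda>v. u @ v) q) p)) \<rparr>"

lemma words_append: "u \<in> words X \<Longrightarrow> v \<in> words X \<Longrightarrow> u @ v \<in> words X"
  by (auto simp: words_def)

lemma word_val_closed:
  assumes "ai_semiring M" "\<phi> \<in> X \<rightarrow> carr M" "w \<in> words X"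
  shows "word_val M \<phi> w \<in> carr M"
  unfolding word_val_def
  using assms by (intro fold1_closed) (auto simp: ai_closed words_def)

lemma poly_val_closed:
  assumes "ai_semiring M" "\<phi> \<in> X \<rightarrow> carr M" "p \<in> carr (poly_alg X)"
  shows "poly_val M \<phi> p \<in> carr M"
  unfolding poly_val_def
  using assms word_val_closed[OF assms(1,2)]
  by (intro fold1_closed) (auto simp: ai_closed poly_alg_def)

lemma poly_val_append:
  assumes M: "ai_semiring M" and \<phi>: "\<phi> \<in> X \<rightarrow> carr M"
    and "p \<in> carr (poly_alg X)" "q \<in> carr (poly_alg X)"
  shows "poly_val M \<phi> (p @ q) = plus_of M (poly_val M \<phi> p) (poly_val M \<phi> q)"
  unfolding poly_val_def map_append
  using assms word_val_closed[OF assms(1,2)]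
  by (intro fold1_append[where C = "carr M"]) (auto simp: ai_closed poly_alg_def ai_plus(3))

lemma word_val_append:
  assumes M: "ai_semiring M" and \<phi>: "\<phi> \<in> X \<rightarrow> carr M" and "u \<in> words X" "v \<in> words X"
  shows "word_val M \<phi> (u @ v) = times_of M (word_val M \<phi> u) (word_val M \<phi> v)"
  unfolding word_val_def map_append
  using assms
  by (intro fold1_append[where C = "carr M"]) (auto simp: ai_closed words_def ai_times(1))

lemma poly_val_map_append:
  assumes M: "ai_semiring M" and \<phi>: "\<phi> \<in> X \<rightarrow> carr M" and u: "u \<in> words X"
    and "q \<noteq> []" "set q \<subseteq> words X"
  shows "poly_val M \<phi> (map (\<lambda>v. u @ v) q) = times_of M (word_val M \<phi> u) (poly_val M \<phi> q)"
  using assms(4,5)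
proof (induction q rule: list_nonempty_induct)
  case (single v)
  then show ?case using word_val_append[OF M \<phi> u] by (simp add: poly_val_def)
next
  case (cons v q)
  have "word_val M \<phi> u \<in> carr M" "word_val M \<phi> v \<in> carr M" "poly_val M \<phi> q \<in> carr M"
    using cons u by (auto intro!: word_val_closed[OF M \<phi>] poly_val_closed[OF M \<phi>] simp: poly_alg_def)
  moreover have "poly_val M \<phi> (x # r) = plus_of M (word_val M \<phi> x) (poly_val M \<phi> r)" if "r \<noteq> []" for x r
    using that by (simp add: poly_val_def fold1_Cons)
  ultimately show ?case
    using cons word_val_append[OF M \<phi> u] by (simp add: ai_times(2)[OF M])
qed

lemma poly_alg_times_closed:
  assumes "p \<in> carr (poly_alg X)" "q \<in> carr (poly_alg X)"
  shows "times_of (poly_alg X) p q \<in> carr (poly_alg X)"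
  using assms by (cases p) (auto simp: poly_alg_def words_append subset_iff)

lemma is_alg_poly_alg:
  assumes "X \<noteq> {}"
  shows "is_alg (poly_alg X)"
proof -
  obtain x where "x \<in> X" using assms by blast
  then have "[[x]] \<in> carr (poly_alg X)" by (simp add: poly_alg_def words_def)
  then have "carr (poly_alg X) \<noteq> {}" by blast
  then show ?thesis
    using poly_alg_times_closed[of _ X] unfolding is_alg_def by (auto simp: poly_alg_def)
qed

lemma alg_hom_poly_val:
  assumes M: "ai_semiring M" and \<phi>: "\<phi> \<in> X \<rightarrow> carr M" and X: "X \<noteq> {}"
  shows "alg_hom (poly_alg X) M (poly_val M \<phi>)"
proof -
  have times: "poly_val M \<phi> (times_of (poly_alg X) p q) = times_of M (poly_val M \<phi> p) (poly_val M \<phi> q)"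
    if "p \<noteq> []" "set p \<subseteq> words X" and q: "q \<in> carr (poly_alg X)" for p q
    using that(1,2)
  proof (induction p rule: list_nonempty_induct)
    case (single u)
    then show ?case
      using poly_val_map_append[OF M \<phi>, of u q] q by (simp add: poly_alg_def poly_val_def)
  next
    case (cons u p)
    have p: "p \<in> carr (poly_alg X)" using cons by (simp add: poly_alg_def)
    have uq: "map (\<lambda>v. u @ v) q \<in> carr (poly_alg X)"
      using cons q by (auto simp: poly_alg_def words_append subset_iff)
    have "poly_val M \<phi> (times_of (poly_alg X) (u # p) q) =
        poly_val M \<phi> (map (\<lambda>v. u @ v) q @ times_of (poly_alg X) p q)"
      by (simp add: poly_alg_def)
    also have "\<dots> = plus_of M (poly_val M \<phi> (map (\<lambda>v. u @ v) q)) (poly_val M \<phi> (times_of (poly_alg X) p q))"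
      using poly_val_append[OF M \<phi> uq poly_alg_times_closed[OF p q]] .
    also have "poly_val M \<phi> (map (\<lambda>v. u @ v) q) = times_of M (word_val M \<phi> u) (poly_val M \<phi> q)"
      using cons q by (intro poly_val_map_append[OF M \<phi>]) (auto simp: poly_alg_def)
    also have "poly_val M \<phi> (times_of (poly_alg X) p q) = times_of M (poly_val M \<phi> p) (poly_val M \<phi> q)"
      using cons by simp
    also have "plus_of M (times_of M (word_val M \<phi> u) (poly_val M \<phi> q))
          (times_of M (poly_val M \<phi> p) (poly_val M \<phi> q)) =
        times_of M (plus_of M (word_val M \<phi> u) (poly_val M \<phi> p)) (poly_val M \<phi> q)"
      using M poly_val_closed[OF M \<phi>] p q cons word_val_closed[OF M \<phi>, of u]
      by (simp add: ai_times(3))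
    also have "plus_of M (word_val M \<phi> u) (poly_val M \<phi> p) = poly_val M \<phi> (u # p)"
      using cons by (simp add: poly_val_def fold1_Cons)
    finally show ?case .
  qed
  show ?thesis
    unfolding alg_hom_def
  proof (intro conjI ballI)
    show "is_alg (poly_alg X)" by (rule is_alg_poly_alg[OF X])
    show "is_alg M" using M by (simp add: ai_semiring_def)
    show "poly_val M \<phi> \<in> carr (poly_alg X) \<rightarrow> carr M"
      using poly_val_closed[OF M \<phi>] by auto
    fix p q assume pq: "p \<in> carr (poly_alg X)" "q \<in> carr (poly_alg X)"
    show "poly_val M \<phi> (plus_of (poly_alg X) p q) = plus_of M (poly_val M \<phi> p) (poly_val M \<phi> q)"
      using poly_val_append[OF M \<phi> pq] by (simp add: poly_alg_def)
    show "poly_val M \<phi> (times_of (poly_alg X) p q) = times_of M (poly_val M \<phi> p) (poly_val M \<phi> q)"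
      using times[OF _ _ pq(2)] pq(1) by (auto simp: poly_alg_def)
  qed
qed

lemma poly_val_le_iff:
  assumes M: "ai_semiring M" and \<phi>: "\<phi> \<in> X \<rightarrow> carr M" and "p \<in> carr (poly_alg X)" "m \<in> carr M"
  shows "alg_le M (poly_val M \<phi> p) m \<longleftrightarrow> (\<forall>w\<in>set p. alg_le M (word_val M \<phi> w) m)"
proof -
  have "p \<noteq> []" "set p \<subseteq> words X" using assms by (auto simp: poly_alg_def)
  then show ?thesis
  proof (induction p rule: list_nonempty_induct)
    case (single w)
    then show ?case by (simp add: poly_val_def)
  next
    case (cons w p)
    have "poly_val M \<phi> (w # p) = plus_of M (word_val M \<phi> w) (poly_val M \<phi> p)"
      using cons by (simp add: poly_val_def fold1_Cons)
    moreover have "word_val M \<phi> w \<in> carr M" "poly_val M \<phi> p \<in> carr M"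
      using cons by (auto intro!: word_val_closed[OF M \<phi>] poly_val_closed[OF M \<phi>] simp: poly_alg_def)
    ultimately show ?case
      using cons plus_le_iff[OF M _ _ assms(4)] by simp
  qed
qed

section \<open>Graphs without odd closed walks\<close>

text \<open>
  In every connected component a root is chosen; a vertex gets its colour from the existence of an
  even walk from the root. Walks of both parities to one vertex, or of the same parity to both
  ends of an edge, would close up to an odd walk at the root. Loops are covered by \<open>n = 0\<close>.
\<close>

lemma two_colouring:
  assumes sym: "symp adj"
    and odd: "\<And>x n. \<not> (adj ^^ (2 * n + 1)) x x"
  obtains col :: "'a \<Rightarrow> bool" where "\<And>x y. adj x y \<Longrightarrow> col x \<noteq> col y"
proof
  have rev: "(adj ^^ n) x y \<Longrightarrow> (adj ^^ n) y x" for n x y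
  proof (induction n arbitrary: y)
    case (Suc n)
    then obtain z where "(adj ^^ n) x z" "adj z y" by (auto elim: relpowp_Suc_E)
    then have "adj y z" "(adj ^^ n) z x" using Suc sym by (auto dest: sympD)
    then show ?case by (rule relpowp_Suc_I2)
  qed simp
  define root where "root x = (SOME r. \<exists>n. (adj ^^ n) r x)" for x
  have root: "\<exists>n. (adj ^^ n) (root x) x" for x
    unfolding root_def by (rule someI_ex) (metis relpowp_0_I)
  define col where "col x = (\<exists>n. even n \<and> (adj ^^ n) (root x) x)" for x
  show "col x \<noteq> col y" if xy: "adj x y" for x y
  proof -
    have yx: "adj y x" using sympD[OF sym xy] .
    have "(\<exists>n. (adj ^^ n) r x) \<longleftrightarrow> (\<exists>n. (adj ^^ n) r y)" for r
      using relpowp_Suc_I[where P = adj, OF _ xy] relpowp_Suc_I[where P = adj, OF _ yx] by blast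
    then have eq: "root x = root y" by (simp add: root_def)
    have "\<not> (col x \<and> col y)"
    proof
      assume "col x \<and> col y"
      then obtain k l where kl: "even k" "(adj ^^ k) (root x) x" "even l" "(adj ^^ l) (root x) y"
        by (auto simp: col_def eq)
      have "(adj ^^ (Suc k + l)) (root x) (root x)"
        unfolding relpowp_add using relpowp_Suc_I[OF kl(2) xy] rev[OF kl(4)] by (rule relcomppI)
      moreover have "Suc k + l = 2 * ((k + l) div 2) + 1" using kl by presburger
      ultimately show False using odd by metis
    qed
    moreover have "col y" if nx: "\<not> col x"
    proof -
      obtain n where n: "(adj ^^ n) (root x) x" using root by blast
      then have "even (Suc n)" using nx by (auto simp: col_def)
      then show ?thesis
        unfolding col_def eq[symmetric] using relpowp_Suc_I[OF n xy] by (intro exI[of _ "Suc n"] conjI)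
    qed
    ultimately show ?thesis by blast
  qed
qed

section \<open>The seven-element semiring satisfies the identities\<close>

definition ST7_identities :: "identity set" where
  "ST7_identities =
     {var_x \<preceq> var_y \<odot> var_y,
      var_x \<odot> var_x \<approx> var_xi 1 \<odot> var_xi 2 \<odot> var_xi 3,
      var_xi 1 \<preceq> var_xi 2 \<oplus> var_xi 2 \<odot> var_xi 3 \<oplus> var_xi 1 \<odot> var_xi 4}
     \<union> sigma_ineq ` {1..}"

lemma ai_semiring_ST7: "ai_semiring ST7"
  using comm_ai_semiring_ST7 by (simp add: comm_ai_semiring_def)

lemma ST7_times_cases: "times_of ST7 a b = 1 \<or> times_of ST7 a b = 3"
  by (simp add: ST7_def)

lemma ST7_times_eq_3_iff:
  "times_of ST7 a b = 3 \<longleftrightarrow> {a, b} \<in> {{2, 6}, {4, 5}, {5, 6}}"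
  by (simp add: ST7_def)

lemma ST7_le_1: "alg_le ST7 a 1"
  by (simp add: alg_le_def ST7_def)

lemma ST7_1_le_iff: "alg_le ST7 1 b \<longleftrightarrow> b = 1"
  by (auto simp: alg_le_def ST7_def)

lemma ST7_square: "times_of ST7 a a = 1"
  by (auto simp: ST7_def doubleton_eq_iff)

lemma ST7_times_1: "times_of ST7 a 1 = 1"
  by (simp add: ST7_def doubleton_eq_iff)

lemma ST7_times_times: "times_of ST7 a (times_of ST7 b c) = 1" "times_of ST7 (times_of ST7 b c) a = 1"
  using ST7_times_cases[of b c] by (auto simp: ST7_def doubleton_eq_iff)

lemma ST7_path_le:
  assumes "a \<in> {2, 4, 5, 6}"
  shows "alg_le ST7 a 7" "\<not> alg_le ST7 a 3"
  using assms by (auto simp: alg_le_def ST7_def doubleton_eq_iff)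

lemma ST7_3_le: "alg_le ST7 3 3" "alg_le ST7 3 7"
  by (simp_all add: alg_le_def ST7_def doubleton_eq_iff)

text \<open>
  If the sum were not the top element, all its products would be \<open>3\<close>, so consecutive letters would
  take values alternately in the two sides \<open>{2, 5}\<close> and \<open>{4, 6}\<close> of the path. This is
  impossible around an odd cycle.
\<close>

lemma ST7_sigma: "ST7 \<Turnstile> sigma_ineq n"
  unfolding sigma_ineq_def satisfies_trm_le
proof (intro allI impI)
  fix v :: "letter \<Rightarrow> nat" assume v: "range v \<subseteq> carr ST7"
  let ?t = "trm_sum (var_xi 1 \<odot> var_xi 2)
    (map (\<lambda>i. var_xi i \<odot> var_xi (i + 1)) [2..<2 * n + 1] @ [var_xi (2 * n + 1) \<odot> var_xi 1])"
  define s where "s = trm_val ST7 v ?t"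
  define a where "a i = v (Letter_xi i)" for i
  have s: "s \<in> carr ST7"
    unfolding s_def using trm_val_in_carr v ai_semiring_ST7 by (auto simp: ai_semiring_def)
  have "alg_le ST7 (trm_val ST7 v ?t) s"
    using alg_le_refl[OF ai_semiring_ST7 s] by (simp add: s_def)
  note le = this[unfolded trm_val_trm_sum_le_iff[OF ai_semiring_ST7 v s]]
  have "s = 1"
  proof (rule ccontr)
    assume "s \<noteq> 1"
    then have three: "times_of ST7 b c = 3" if "alg_le ST7 (times_of ST7 b c) s" for b c
      using that ST7_times_cases[of b c] ST7_1_le_iff[of s] by auto
    have flip: "b \<in> {2, 4, 5, 6} \<and> c \<in> {2, 4, 5, 6} \<and> (b \<in> {2, 5} \<longleftrightarrow> c \<notin> {2, 5})"
      if "times_of ST7 b c = 3" for b c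
      using that unfolding ST7_times_eq_3_iff by (auto simp: doubleton_eq_iff)
    have edge: "times_of ST7 (a i) (a (Suc i)) = 3" if "1 \<le> i" "i \<le> 2 * n" for i
    proof (cases "i = 1")
      case True
      then show ?thesis using le by (auto intro!: three simp: a_def numeral_2_eq_2)
    next
      case False
      then have "i \<in> set [2..<2 * n + 1]" using that by auto
      then show ?thesis using le by (auto intro!: three simp: a_def)
    qed
    have last: "times_of ST7 (a (2 * n + 1)) (a 1) = 3"
      using le by (auto intro!: three simp: a_def)
    have "a (Suc i) \<in> {2, 5} \<longleftrightarrow> (a 1 \<in> {2, 5} \<longleftrightarrow> even i)" if "i \<le> 2 * n" for i
      using that
    proof (induction i)
      case (Suc i)
      then show ?case using flip[OF edge[of "Suc i"]] by auto
    qed simp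
    from this[of "2 * n"] show False using flip[OF last] by auto
  qed
  then show "alg_le ST7 (trm_val ST7 v var_x) (trm_val ST7 v ?t)"
    using ST7_le_1 by (simp add: s_def)
qed

lemma ST7_models: "ST7 \<in> models ST7_identities"
proof -
  have "alg_le ST7 x (plus_of ST7 (plus_of ST7 y (times_of ST7 y z)) (times_of ST7 x w))" for x y z w
  proof (cases "times_of ST7 y z = 3 \<and> times_of ST7 x w = 3")
    case True
    then have "y \<in> {2, 4, 5, 6}" "x \<in> {2, 4, 5, 6}"
      unfolding ST7_times_eq_3_iff by (auto simp: doubleton_eq_iff)
    then show ?thesis using True by (auto simp: alg_le_def ST7_def doubleton_eq_iff)
  next
    case False
    then have "times_of ST7 y z = 1 \<or> times_of ST7 x w = 1" using ST7_times_cases by blast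
    moreover have "plus_of ST7 a 1 = 1" "plus_of ST7 1 a = 1" for a by (simp_all add: ST7_def)
    ultimately have "plus_of ST7 (plus_of ST7 y (times_of ST7 y z)) (times_of ST7 x w) = 1" by auto
    then show ?thesis using ST7_le_1 by simp
  qed
  then show ?thesis
    using comm_ai_semiring_ST7 ST7_sigma
    by (auto simp: models_def ST7_identities_def satisfies_trm_le ST7_square ST7_times_times ST7_le_1 simp del: One_nat_def)
qed

section \<open>Principal ideals are cut out by valuations in the seven-element semiring\<close>

lemma models_ST7_identitiesD:
  assumes "S \<in> models ST7_identities"
    and "a \<in> carr S" "b \<in> carr S" "c \<in> carr S" "d \<in> carr S"
  shows "alg_le S a (times_of S b b)"
    and "times_of S a a = times_of S (times_of S b c) d"
    and "alg_le S a (plus_of S (plus_of S b (times_of S b c)) (times_of S a d))"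
proof -
  let ?v = "\<lambda>l. case l of Letter_x \<Rightarrow> a | Letter_y \<Rightarrow> b | Letter_xi n \<Rightarrow>
    (if n = 1 then b else if n = 2 then c else d)"
  let ?u = "\<lambda>l. case l of Letter_x \<Rightarrow> a | Letter_y \<Rightarrow> b | Letter_xi n \<Rightarrow>
    (if n = 1 then a else if n = 2 then b else if n = 3 then c else d)"
  have v: "range ?v \<subseteq> carr S" "range ?u \<subseteq> carr S" using assms by (auto split: letter.split)
  have sat: "S \<Turnstile> i" if "i \<in> ST7_identities" for i using assms(1) that by (auto simp: models_def)
  have s1: "S \<Turnstile> (var_x \<preceq> var_y \<odot> var_y)"
    and s2: "S \<Turnstile> (var_x \<odot> var_x \<approx> var_xi 1 \<odot> var_xi 2 \<odot> var_xi 3)"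
    and s3: "S \<Turnstile> (var_xi 1 \<preceq> var_xi 2 \<oplus> var_xi 2 \<odot> var_xi 3 \<oplus> var_xi 1 \<odot> var_xi 4)"
    by (intro sat; simp add: ST7_identities_def)+
  show "alg_le S a (times_of S b b)"
    using s1[unfolded satisfies_trm_le, rule_format, OF v(1)] by simp
  show "times_of S a a = times_of S (times_of S b c) d"
    using s2[unfolded satisfies.simps, rule_format, OF v(1)] by simp
  show "alg_le S a (plus_of S (plus_of S b (times_of S b c)) (times_of S a d))"
    using s3[unfolded satisfies_trm_le, rule_format, OF v(2)] by simp
qed

text \<open>
  A walk of length \<open>2n + 1\<close> is an instance of the right-hand side of \<open>\<sigma>\<^sub>n\<close>. For \<open>n = 0\<close> it is a
  loop \<open>xx \<le> s\<close>, and squares are top elements by the identity \<open>x \<preceq> y\<^sup>2\<close>.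
\<close>

lemma models_ST7_odd_walk:
  assumes S: "S \<in> models ST7_identities" and s: "s \<in> carr S" and y: "y \<in> carr S"
    and walk: "((\<lambda>x y. x \<in> carr S \<and> y \<in> carr S \<and> alg_le S (times_of S x y) s) ^^ (2 * n + 1)) x x"
  shows "alg_le S y s"
proof -
  have ai: "ai_semiring S" using S by (auto simp: models_def comm_ai_semiring_def)
  obtain f where f: "f 0 = x" "f (2 * n + 1) = x"
      "\<And>i. i < 2 * n + 1 \<Longrightarrow> f i \<in> carr S \<and> f (Suc i) \<in> carr S \<and> alg_le S (times_of S (f i) (f (Suc i))) s"
    using walk unfolding relpowp_fun_conv by auto
  show ?thesis
  proof (cases "n = 0")
    case True
    then have "x \<in> carr S" "alg_le S (times_of S x x) s" using f(3)[of 0] f(1,2) by auto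
    then show ?thesis
      using models_ST7_identitiesD(1)[OF S y] alg_le_trans[OF ai y _ s] ai_closed[OF ai] by blast
  next
    case False
    let ?t = "trm_sum (var_xi 1 \<odot> var_xi 2)
      (map (\<lambda>i. var_xi i \<odot> var_xi (i + 1)) [2..<2 * n + 1] @ [var_xi (2 * n + 1) \<odot> var_xi 1])"
    define v where "v l = (case l of Letter_xi i \<Rightarrow> if 1 \<le> i \<and> i \<le> 2 * n + 1 then f (i - 1) else y | _ \<Rightarrow> y)" for l
    have v: "range v \<subseteq> carr S" using f(3) y by (auto simp: v_def split: letter.split)
    have "S \<Turnstile> sigma_ineq n" using S False by (auto simp: models_def ST7_identities_def)
    from this[unfolded sigma_ineq_def satisfies_trm_le, rule_format, OF v]
    have "alg_le S (v Letter_x) (trm_val S v ?t)" by (simp only: trm_val.simps)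
    then have le: "alg_le S y (trm_val S v ?t)" by (simp only: v_def letter.case)
    have "alg_le S (trm_val S v ?t) s"
      unfolding trm_val_trm_sum_le_iff[OF ai v s]
    proof
      fix r assume "r \<in> insert (var_xi 1 \<odot> var_xi 2)
        (set (map (\<lambda>i. var_xi i \<odot> var_xi (i + 1)) [2..<2 * n + 1] @ [var_xi (2 * n + 1) \<odot> var_xi 1]))"
      then consider i where "1 \<le> i" "i \<le> 2 * n" "r = var_xi i \<odot> var_xi (i + 1)"
        | "r = var_xi (2 * n + 1) \<odot> var_xi 1"
        using False by (auto simp: numeral_2_eq_2)
      then show "alg_le S (trm_val S v r) s"
      proof cases
        case 1
        then show ?thesis using f(3)[of "i - 1"] by (simp add: v_def)
      next
        case 2
        then show ?thesis using f(3)[of "2 * n"] f(1,2) by (simp add: v_def)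
      qed
    qed
    moreover have "trm_val S v ?t \<in> carr S"
      using trm_val_in_carr[OF _ v] ai by (auto simp: ai_semiring_def)
    ultimately show ?thesis using alg_le_trans[OF ai y _ s le] by blast
  qed
qed

text \<open>
  In the graph of the pairs with product at most \<open>s\<close>, the valuation \<open>\<phi> x\<close> has to respect all
  edges and to break every non-edge at \<open>x\<close>. Giving the colour class of \<open>x\<close> the value \<open>5\<close> and the
  other class the values \<open>6\<close> or \<open>4\<close> respects all edges not at \<open>x\<close>, since \<open>5\<close> is joined to both.
  The vertex \<open>x\<close> itself gets the end point \<open>2\<close> of the path, which is joined to \<open>6\<close> only, and so
  \<open>6\<close> is reserved for the neighbours of \<open>x\<close>.
\<close>

lemma models_ST7_cut:
  assumes S: "S \<in> models ST7_identities" and s: "s \<in> carr S"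
  obtains \<phi> c where "\<And>x. \<phi> x \<in> carr S \<rightarrow> carr ST7" "c \<in> carr ST7"
    "\<And>w. w \<in> words (carr S) \<Longrightarrow>
      alg_le S (word_val S id w) s \<longleftrightarrow> (\<forall>x\<in>carr S. alg_le ST7 (word_val ST7 (\<phi> x) w) c)"
proof (cases "\<forall>y\<in>carr S. alg_le S y s")
  case True
  have ai: "ai_semiring S" using S by (auto simp: models_def comm_ai_semiring_def)
  have "alg_le S (word_val S id w) s" if "w \<in> words (carr S)" for w
    using True word_val_closed[OF ai _ that, of id] by auto
  then show ?thesis
    using ST7_le_1 by (intro that[of "\<lambda>_ _. 1" 1]) (auto simp: ST7_def)
next
  case False
  then obtain y where y: "y \<in> carr S" "\<not> alg_le S y s" by blast
  have ai: "ai_semiring S" and comm: "comm_ai_semiring S"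
    using S by (auto simp: models_def comm_ai_semiring_def)
  note ax = models_ST7_identitiesD[OF S]
  have sq: "\<not> alg_le S (times_of S x x) s" if "x \<in> carr S" for x
    using y ax(1)[OF y(1) that] alg_le_trans[OF ai y(1) _ s] ai_closed[OF ai that that] that by blast
  define adj where "adj = (\<lambda>x y. x \<in> carr S \<and> y \<in> carr S \<and> alg_le S (times_of S x y) s)"
  have sym: "symp adj"
    using comm by (auto simp: symp_def adj_def comm_ai_semiring_def)
  have odd: "\<not> (adj ^^ (2 * n + 1)) x x" for x n
    using models_ST7_odd_walk[OF S s y(1), of n x, folded adj_def] y(2) by (rule contrapos_nn[rotated])
  obtain col :: "'a \<Rightarrow> bool" where col: "\<And>x y. adj x y \<Longrightarrow> col x \<noteq> col y"
    using two_colouring[OF sym odd] by metis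
  define touched where "touched x = (\<exists>y. adj x y)" for x
  have adjD: "x \<in> carr S" "z \<in> carr S" "touched x" "touched z" "x \<noteq> z" if "adj x z" for x z
    using that sq sympD[OF sym that] by (auto simp: adj_def touched_def)
  have spread: "alg_le S x s" if x: "touched x" and l: "touched l" "alg_le S l s" for x l
  proof -
    obtain a b where ab: "adj x a" "adj l b" using x l by (auto simp: touched_def)
    then have c: "x \<in> carr S" "a \<in> carr S" "l \<in> carr S" "b \<in> carr S" by (auto simp: adj_def)
    have "alg_le S (plus_of S (plus_of S l (times_of S l b)) (times_of S x a)) s"
      using ab l c s by (simp add: plus_le_iff ai ai_closed adj_def)
    moreover have "plus_of S (plus_of S l (times_of S l b)) (times_of S x a) \<in> carr S"
      using c by (simp add: ai_closed ai)
    ultimately show ?thesis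
      using alg_le_trans[OF ai c(1) _ s ax(3)[OF c(1,3,4,2)]] by simp
  qed
  \<comment> \<open>Isolated vertices below \<open>s\<close> get the largest value that is allowed, other isolated ones the top \<open>1\<close>.\<close>
  define c :: nat where "c = (if \<exists>l. touched l \<and> alg_le S l s then 7 else 3)"
  define \<phi> :: "'a \<Rightarrow> 'a \<Rightarrow> nat" where "\<phi> x z =
    (if touched z then
       (if z = x then 2 else if col z = col x then 5 else if adj x z then 6 else 4)
     else if alg_le S z s then c else 1)" for x z
  show ?thesis
  proof (rule that[of \<phi> c])
    show "\<phi> x \<in> carr S \<rightarrow> carr ST7" for x by (auto simp: \<phi>_def c_def ST7_def)
    show c_in: "c \<in> carr ST7" by (auto simp: c_def ST7_def)
    fix w assume w: "w \<in> words (carr S)"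
    have not1: "\<not> alg_le ST7 1 c" by (simp add: ST7_1_le_iff c_def del: One_nat_def)
    consider z where "w = [z]" | z z' where "w = [z, z']" | z z' z'' r where "w = z # z' # z'' # r"
      using w unfolding words_def by (metis (mono_tags, lifting) mem_Collect_eq neq_Nil_conv)
    then show "alg_le S (word_val S id w) s \<longleftrightarrow> (\<forall>x\<in>carr S. alg_le ST7 (word_val ST7 (\<phi> x) w) c)"
    proof cases
      case 1
      have "alg_le ST7 (\<phi> x z) c \<longleftrightarrow> alg_le S z s" for x
      proof (cases "touched z")
        case True
        then have "(\<exists>l. touched l \<and> alg_le S l s) \<longleftrightarrow> alg_le S z s" using spread by blast
        then have "c = (if alg_le S z s then 7 else 3)" by (simp only: c_def)
        moreover have "\<phi> x z \<in> {2, 4, 5, 6}" using True by (simp add: \<phi>_def)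
        ultimately show ?thesis using ST7_path_le by simp
      next
        case False
        then have "\<phi> x z = (if alg_le S z s then c else 1)" by (simp only: \<phi>_def if_False)
        then show ?thesis using not1 alg_le_refl[OF ai_semiring_ST7 c_in] by simp
      qed
      then show ?thesis using 1 y(1) by (auto simp: word_val_def)
    next
      case 2
      then have z: "z \<in> carr S" "z' \<in> carr S" using w by (auto simp: words_def)
      have "alg_le ST7 3 c" using ST7_3_le by (simp add: c_def)
      moreover have "times_of ST7 (\<phi> x z) (\<phi> x z') = 3" if a: "adj z z'" for x
      proof -
        have c2: "col z \<longleftrightarrow> \<not> col z'" using col[OF a] by simp
        show ?thesis
          unfolding ST7_times_eq_3_iff using adjD(3,4,5)[OF a] a sympD[OF sym a] c2
          by (cases "z = x"; cases "z' = x"; cases "col z' = col x") (simp_all add: \<phi>_def doubleton_eq_iff)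
      qed
      moreover have "times_of ST7 (\<phi> z z) (\<phi> z z') = 1" if a: "\<not> adj z z'"
      proof -
        have "times_of ST7 (\<phi> z z) (\<phi> z z') \<noteq> 3"
          unfolding ST7_times_eq_3_iff using a by (simp add: \<phi>_def c_def doubleton_eq_iff)
        then show ?thesis using ST7_times_cases by blast
      qed
      \<comment> \<open>A non-edge \<open>z z'\<close> is detected by the valuation with index \<open>z\<close>.\<close>
      ultimately have "adj z z' \<longleftrightarrow> (\<forall>x\<in>carr S. alg_le ST7 (times_of ST7 (\<phi> x z) (\<phi> x z')) c)"
        using z(1) not1 by metis
      then show ?thesis using 2 z by (simp add: word_val_def adj_def)
    next
      case 3
      have "word_val ST7 (\<phi> x) w = 1" for x
        using 3 by (cases r) (simp_all add: word_val_def ST7_times_times ST7_times_1 del: One_nat_def)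
      moreover have "\<not> alg_le S (word_val S id w) s"
      proof -
        have c3: "z \<in> carr S" "z' \<in> carr S" "z'' # r \<in> words (carr S)" 
          using w 3 by (auto simp: words_def)
        have t: "word_val S id (z'' # r) \<in> carr S"
          using word_val_closed[OF ai _ c3(3), of id] by simp
        have "word_val S id w = times_of S z (times_of S z' (word_val S id (z'' # r)))"
          using 3 by (simp add: word_val_def)
        also have "\<dots> = times_of S (times_of S z z') (word_val S id (z'' # r))"
          using ai_times(1)[OF ai] c3 t by simp
        also have "\<dots> = times_of S z z" using ax(2) c3 t by metis
        finally show ?thesis using sq c3 by simp
      qed
      ultimately show ?thesis using not1 y(1) by auto
    qed
  qed
qed

section \<open>Completeness\<close>

text \<open>
  The graph of a function \<open>'a \<times> 'a \<Rightarrow> nat\<close> is a set of triples, and triples can be coded in the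
  infinite type \<open>'a + nat\<close> because an infinite set is equipotent to its square.
\<close>

lemma inj_fun_into_universe:
  fixes e :: "('a + nat) set \<Rightarrow> 'u"
  assumes "inj e"
  obtains E :: "('a \<times> 'a \<Rightarrow> nat) \<Rightarrow> 'u" where "inj E"
proof -
  have "infinite (UNIV :: ('a + nat) set)" by simp
  then obtain p where "bij_betw p ((UNIV :: ('a + nat) set) \<times> (UNIV :: ('a + nat) set)) (UNIV :: ('a + nat) set)"
    using card_of_Times_same_infinite[folded card_of_ordIso] by blast
  then have p: "inj p" by (simp add: bij_betw_def)
  define E where "E g = e {p (p (Inl x, Inl y), Inr (g (x, y))) | x y. True}" for g :: "'a \<times> 'a \<Rightarrow> nat"
  have "inj E"
  proof (rule injI)
    fix g h assume "E g = E h"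
    then have eq: "{p (p (Inl x, Inl y), Inr (g (x, y))) | x y. True} = {p (p (Inl x, Inl y), Inr (h (x, y))) | x y. True}"
      using assms by (simp add: E_def inj_eq)
    have "g (x, y) = h (x, y)" for x y
    proof -
      have "p (p (Inl x, Inl y), Inr (g (x, y))) \<in> {p (p (Inl x, Inl y), Inr (h (x, y))) | x y. True}"
        unfolding eq[symmetric] by blast
      then show ?thesis using p by (auto simp: inj_eq)
    qed
    then show "g = h" by auto
  qed
  then show thesis by (rule that)
qed

lemma models_subset_variety_ST7:
  fixes e :: "('a + nat) set \<Rightarrow> 'u" and S :: "'a alg"
  assumes e: "inj e" and S: "S \<in> models ST7_identities"
  shows "S \<in> variety TYPE('u) ST7"
proof -
  have ai: "ai_semiring S" using S by (auto simp: models_def comm_ai_semiring_def)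
  then have alg: "is_alg S" "carr S \<noteq> {}" by (auto simp: ai_semiring_def is_alg_def)
  obtain E :: "('a \<times> 'a \<Rightarrow> nat) \<Rightarrow> 'u" where E: "inj E" using inj_fun_into_universe[OF e] .
  define d where "d j = E (\<lambda>i. if i = j then 1 else 0)" for j
  have d: "inj d"
  proof (rule injI)
    fix i j assume "d i = d j"
    then have "(\<lambda>k. if k = i then 1 else 0 :: nat) = (\<lambda>k. if k = j then 1 else 0)"
      using E by (simp add: d_def inj_eq)
    from fun_cong[OF this, of i] show "i = j" by (simp split: if_splits)
  qed
  \<comment> \<open>A copy of \<open>S\<close> inside the universe.\<close>
  define \<tau> where "\<tau> a = d (a, a)" for a
  have \<tau>: "inj \<tau>" using d by (auto simp: \<tau>_def inj_def)
  define T where "T = copy_alg \<tau> S"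
  have T: "alg_hom S T \<tau>" "alg_iso S T"
    unfolding T_def using alg_iso_copy[OF alg(1) inj_on_subset[OF \<tau> subset_UNIV]] by auto
  have "\<forall>s. \<exists>\<phi> c. s \<in> carr S \<longrightarrow> (\<forall>x. \<phi> x \<in> carr S \<rightarrow> carr ST7) \<and> c \<in> carr ST7 \<and>
    (\<forall>w\<in>words (carr S). 
      alg_le S (word_val S id w) s \<longleftrightarrow> (\<forall>x\<in>carr S. alg_le ST7 (word_val ST7 (\<phi> x) w) c))"
    by (metis models_ST7_cut[OF S])
  then obtain \<phi> c where \<phi>: "\<And>s x. s \<in> carr S \<Longrightarrow> \<phi> s x \<in> carr S \<rightarrow> carr ST7"
      and c: "\<And>s. s \<in> carr S \<Longrightarrow> c s \<in> carr ST7"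
      and cut: "\<And>s w. s \<in> carr S \<Longrightarrow> w \<in> words (carr S) \<Longrightarrow>
        alg_le S (word_val S id w) s \<longleftrightarrow> (\<forall>x\<in>carr S. alg_le ST7 (word_val ST7 (\<phi> s x) w) (c s))"
    by metis
  \<comment> \<open>Pairs that do not index one of the valuations get a constant one, so that the exponent
      can be the whole type of pairs.\<close>
  define \<psi> where "\<psi> j = (if fst j \<in> carr S then \<phi> (fst j) (snd j) else (\<lambda>_. 1))" for j
  have \<psi>: "\<psi> j \<in> carr S \<rightarrow> carr ST7" for j
    using \<phi> by (auto simp: \<psi>_def ST7_def)
  let ?W = "poly_alg (carr S)"
  have id: "id \<in> carr S \<rightarrow> carr S" by simp
  have T_in: "T \<in> variety_class ST7"
  proof (rule variety_class_if_separated[OF d E])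
    show "alg_hom ?W ST7 (poly_val ST7 (\<psi> j))" for j
      by (rule alg_hom_poly_val[OF ai_semiring_ST7 \<psi> alg(2)])
    show "alg_hom ?W T (\<tau> \<circ> poly_val S id)"
      by (rule alg_hom_comp[OF alg_hom_poly_val[OF ai id alg(2)] T(1)])
    show "(\<tau> \<circ> poly_val S id) ` carr ?W = carr T"
    proof -
      have "a = poly_val S id [[a]]" "[[a]] \<in> carr ?W" if "a \<in> carr S" for a
        using that by (auto simp: poly_val_def word_val_def poly_alg_def words_def)
      then have "poly_val S id ` carr ?W = carr S"
        using poly_val_closed[OF ai id] by blast
      then show ?thesis by (simp only: T_def copy_alg_def Let_def alg.select_convs image_comp[symmetric])
    qed
    fix p q assume p: "p \<in> carr ?W" and q: "q \<in> carr ?W"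
      and eq: "\<And>j. poly_val ST7 (\<psi> j) p = poly_val ST7 (\<psi> j) q"
    have le: "alg_le S (poly_val S id r) s \<longleftrightarrow>
        (\<forall>x\<in>carr S. alg_le ST7 (poly_val ST7 (\<psi> (s, x)) r) (c s))"
      if s: "s \<in> carr S" and r: "r \<in> carr ?W" for s r
    proof -
      have "set r \<subseteq> words (carr S)" using r by (simp add: poly_alg_def)
      then show ?thesis
        unfolding poly_val_le_iff[OF ai id r s] poly_val_le_iff[OF ai_semiring_ST7 \<psi> r c[OF s]]
        using cut[OF s] s by (auto simp: \<psi>_def)
    qed
    have pq: "poly_val S id p \<in> carr S" "poly_val S id q \<in> carr S"
      using poly_val_closed[OF ai id] p q by auto
    have "alg_le S (poly_val S id p) s \<longleftrightarrow> alg_le S (poly_val S id q) s" if "s \<in> carr S" for s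
      using le[OF that p] le[OF that q] eq by simp
    then have "poly_val S id p = poly_val S id q"
      using alg_le_antisym[OF ai pq] alg_le_refl[OF ai] pq by blast
    then show "(\<tau> \<circ> poly_val S id) p = (\<tau> \<circ> poly_val S id) q" by simp
  qed
  then show ?thesis using alg_iso_sym[OF T(2)] by (auto simp: variety_def)
qed

theorem proposition5p2:
  fixes e :: "('a + nat) set \<Rightarrow> 'u"
  assumes universe_large: "inj e"
  shows "variety TYPE('u) ST7 =
    {S :: 'a alg. comm_ai_semiring S \<and>
       S \<Turnstile> (var_x \<preceq> var_y \<odot> var_y) \<and>
       S \<Turnstile> (var_x \<odot> var_x \<approx> var_xi 1 \<odot> var_xi 2 \<odot> var_xi 3) \<and>
       S \<Turnstile> (var_xi 1 \<preceq> var_xi 2 \<oplus> var_xi 2 \<odot> var_xi 3 \<oplus> var_xi 1 \<odot> var_xi 4) \<and>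
       (\<forall>n\<ge>1. S \<Turnstile> sigma_ineq n)}"
proof -
  have "variety TYPE('u) ST7 = (models ST7_identities :: 'a alg set)"
    using variety_subset_models[OF ST7_models] models_subset_variety_ST7[OF universe_large] by blast
  then show ?thesis by (auto simp: models_def ST7_identities_def)
qed

end
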